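(* Let $x_1\geq x_2\geq x_3\geq x_4$ be real numbers such that $x_1+x_4\geq x_2+x_3$. Let $a_1,a_2,a_3,a_4\in\mathbb{R}$ with $a_1\geq \max(|a_2|,|a_4|)$ and $a_3\geq |a_4|$, and let $g:\mathbb{R}\to\mathbb{R}$ be a function in class $\mathcal{G}$. Then $$\sum_{i=1}^4 a_i\prod_{\substack{1\leq j\leq 4\\ j\neq i}} g(x_i-x_j)\geq 0.$$
   Context: A function $g:\mathbb{R}\to\mathbb{R}$ is in class $\mathcal{G}$ if $g$ is either even or odd, $g(0)\geq 0$, and $g$ is monotonically nondecreasing on $[0,\infty)$. *)

theory Defs
  imports Complex_Main
begin

definition class_G :: "(real \<Rightarrow> real) set" where
  "class_G = {g. ((\<forall>x. g (- x) = g x) \<or> (\<forall>x. g (- x) = - g x)) \<and>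
                 g 0 \<ge> 0 \<and> mono_on {0..} g}"

end

(* Write p, q, r, s, t, u for the values of g at the differences x i - x j, i < j, in lexicographic
   order. All of them are nonnegative, and up to the signs of a 2 and a 4 the sum is
   a1 pqr + a2 pst + a3 qsu + a4 rtu. The condition x 1 + x 4 >= x 2 + x 3 gives u <= p and t <= q,
   so the extremal case a1 = a3 = -a2 = -a4 is p(qr - st) + u(qs - rt), which is either a sum of
   nonnegative terms or at least p(q - t)(r + s). *)
theory Submission imports Defs begin

lemma class_G_mono:
  assumes "g \<in> class_G" "0 \<le> y" "y \<le> z"
  shows "g y \<le> g z"
proof -
  have "mono_on {0..} g"
    using assms(1) by (simp add: class_G_def)
  then show ?thesis
    by (rule mono_onD) (use assms in simp_all)
qed

lemma class_G_nonneg: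
  assumes "g \<in> class_G" "0 \<le> y"
  shows "0 \<le> g y"
proof -
  have "0 \<le> g 0"
    using assms(1) by (simp add: class_G_def)
  also have "g 0 \<le> g y"
    using assms by (simp add: class_G_mono)
  finally show ?thesis .
qed

text \<open>The sum is linear in the coefficients, so it is smallest at extreme values of
  \<open>b\<close>, \<open>c\<close> and \<open>d\<close>. Bounding \<open>b\<close> and
  \<open>d\<close> only in absolute value lets one inequality serve both parities of
  \<open>g\<close>.\<close>

lemma four_term_bound:
  fixes a b c d p q r s t u :: real
  assumes coeffs: "\<bar>b\<bar> \<le> a" "\<bar>d\<bar> \<le> a" "\<bar>d\<bar> \<le> c"
    and nonneg: "0 \<le> s" "0 \<le> u"
    and order: "u \<le> p" "s \<le> t" "t \<le> q" "q \<le> r"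
  shows "0 \<le> a * (p * q * r) + b * (p * s * t) + c * (q * s * u) + d * (r * t * u)"
proof -
  have pos: "0 \<le> p" "0 \<le> q" "0 \<le> r" "0 \<le> t"
    using nonneg order by linarith+
  \<comment> \<open>These three estimates push \<open>b\<close>, \<open>c\<close>, \<open>d\<close>
    down to -a, |d|, -|d|, leaving only \<open>a\<close> and |d|.\<close>
  have "- a * (p * s * t) \<le> b * (p * s * t)"
    using coeffs nonneg pos by (intro mult_right_mono) auto
  moreover have "\<bar>d\<bar> * (q * s * u) \<le> c * (q * s * u)"
    using coeffs nonneg pos by (intro mult_right_mono) auto
  moreover have "- \<bar>d\<bar> * (r * t * u) \<le> d * (r * t * u)"
    using nonneg pos by (intro mult_right_mono) auto
  moreover have "0 \<le> a * (p * (q * r - s * t)) + \<bar>d\<bar> * (u * (q * s - r * t))"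
  proof -
    have "s * t \<le> r * q"
      using nonneg order pos by (intro mult_mono) auto
    then have A: "0 \<le> p * (q * r - s * t)"
      using pos by (simp add: mult.commute)
    have "0 \<le> p * (q * r - s * t) + u * (q * s - r * t)"
    proof (cases "0 \<le> q * s - r * t")
      case True
      then show ?thesis
        using A nonneg by simp
    next
      case False
      \<comment> \<open>The factor \<open>q * s - r * t\<close> is negative here, so raising
        \<open>u\<close> to \<open>p\<close> only lowers the sum, which then factors.\<close>
      then have "p * (q * s - r * t) \<le> u * (q * s - r * t)"
        using order by (intro mult_right_mono_neg) auto
      moreover have "0 \<le> p * ((q - t) * (r + s))"
        using pos nonneg order by simp
      ultimately show ?thesis
        by (simp add: algebra_simps)
    qed
    \<comment> \<open>Split a = |d| + (a - |d|): the first part carries the extremal case, and the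
      excess multiplies only the nonnegative quantity in \<open>A\<close>.\<close>
    then have "0 \<le> \<bar>d\<bar> * (p * (q * r - s * t) + u * (q * s - r * t))"
      by simp
    moreover have "0 \<le> (a - \<bar>d\<bar>) * (p * (q * r - s * t))"
      using A coeffs by simp
    ultimately show ?thesis
      by (simp add: algebra_simps)
  qed
  ultimately show ?thesis
    by (simp add: algebra_simps)
qed

theorem theorem3:
  fixes x a :: "nat \<Rightarrow> real" and g :: "real \<Rightarrow> real"
  assumes "x 1 \<ge> x 2" and "x 2 \<ge> x 3" and "x 3 \<ge> x 4"
    and "x 1 + x 4 \<ge> x 2 + x 3"
    and "a 1 \<ge> max \<bar>a 2\<bar> \<bar>a 4\<bar>"
    and "a 3 \<ge> \<bar>a 4\<bar>"
    and "g \<in> class_G"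
  shows "(\<Sum>i = 1..4. a i * (\<Prod>j \<in> {1..4} - {i}. g (x i - x j))) \<ge> 0"
proof -
  define p q r s t u where "p = g (x 1 - x 2)" and "q = g (x 1 - x 3)" and "r = g (x 1 - x 4)"
    and "s = g (x 2 - x 3)" and "t = g (x 2 - x 4)" and "u = g (x 3 - x 4)"
  note defs = p_def q_def r_def s_def t_def u_def
  have order: "u \<le> p" "s \<le> t" "t \<le> q" "q \<le> r"
    unfolding defs using assms(1-4) by (auto intro!: class_G_mono[OF assms(7)])
  have nonneg: "0 \<le> s" "0 \<le> u"
    unfolding defs using assms(2,3) by (auto intro!: class_G_nonneg[OF assms(7)])
  have bound: "0 \<le> a 1 * (p * q * r) + b * (p * s * t) + a 3 * (q * s * u) + d * (r * t * u)"
    if "\<bar>b\<bar> = \<bar>a 2\<bar>" "\<bar>d\<bar> = \<bar>a 4\<bar>" for b d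
    using that assms(5,6) order nonneg by (intro four_term_bound) auto
  have ivl: "{1..4} = {1, 2, 3, 4 :: nat}"
    by auto
  \<comment> \<open>Reversed differences stay unevaluated, so this expansion holds for either
    parity.\<close>
  have expand: "(\<Sum>i = 1..4. a i * (\<Prod>j \<in> {1..4} - {i}. g (x i - x j))) =
      a 1 * (p * q * r) + a 2 * (g (x 2 - x 1) * s * t)
      + a 3 * (g (x 3 - x 1) * g (x 3 - x 2) * u)
      + a 4 * (g (x 4 - x 1) * g (x 4 - x 2) * g (x 4 - x 3))"
    unfolding ivl defs by (simp add: insert_Diff_if)
  consider (even) "\<And>y. g (- y) = g y" | (odd) "\<And>y. g (- y) = - g y"
    using assms(7) unfolding class_G_def by blast
  then show ?thesis
  proof cases
    case even
    have "g (x 2 - x 1) = p" "g (x 3 - x 1) = q" "g (x 4 - x 1) = r"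
      "g (x 3 - x 2) = s" "g (x 4 - x 2) = t" "g (x 4 - x 3) = u"
      unfolding defs using even[of "x 1 - x 2"] even[of "x 1 - x 3"] even[of "x 1 - x 4"]
        even[of "x 2 - x 3"] even[of "x 2 - x 4"] even[of "x 3 - x 4"]
      by (simp_all only: minus_diff_eq)
    then show ?thesis
      unfolding expand using bound[of "a 2" "a 4"] by simp
  next
    case odd
    have "g (x 2 - x 1) = - p" "g (x 3 - x 1) = - q" "g (x 4 - x 1) = - r"
      "g (x 3 - x 2) = - s" "g (x 4 - x 2) = - t" "g (x 4 - x 3) = - u"
      unfolding defs using odd[of "x 1 - x 2"] odd[of "x 1 - x 3"] odd[of "x 1 - x 4"]
        odd[of "x 2 - x 3"] odd[of "x 2 - x 4"] odd[of "x 3 - x 4"]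
      by (simp_all only: minus_diff_eq)
    then show ?thesis
      \<comment> \<open>The product for index i has i - 1 reversed differences, hence sign
        (-1)^(i-1): only the terms of \<open>a 2\<close> and \<open>a 4\<close> change sign.\<close>
      unfolding expand using bound[of "- a 2" "- a 4"] by simp
  qed
qed

end
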